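(* Consider a trait-based time-extended task allocation problem (as defined in the context) that has at least one solution. Let $C(\sigma^* )$ be the optimal makespan, i.e. the smallest makespan $C(\sigma_A)$ over all valid allocations $A$ that admit a feasible schedule. Let $C(\hat\sigma)$ be the makespan of the solution generated by D-ITAGS, i.e. $\hat\sigma=\sigma_{\hat N}$ where $\hat N$ is the node returned by the best-first search described in the context, run with the heuristic $f_{tetaq}=\alpha f_{apr}+(1-\alpha)f_{nsq}$ with parameter $\alpha\in[0,1]$. If $\alpha<0.5$, then $$C(\hat\sigma)-C(\sigma^* )\ \le\ \frac{\alpha}{1-\alpha}\,\bigl(C(\sigma_{UB})-C(\sigma_{LB})\bigr),$$ where $C(\sigma_{LB})$ and $C(\sigma_{UB})$ are the estimated lower and upper bounds, respectively, on the makespan of any valid solution.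
   Context: **Problem.** There are $N$ robots, $M\ge 1$ tasks $a_1,\dots,a_M$ and $U$ traits. The team trait matrix is $Q\in\mathbb{R}_{\ge0}^{N\times U}$, where $Q_{iu}$ is the amount of trait $u$ possessed by robot $i$. The desired trait matrix is $Y^*\in\mathbb{R}_{\ge0}^{M\times U}$, $Y^*\neq 0$, where $Y^*_{mu}$ is the amount of trait $u$ required by task $a_m$. Task $a_i$ has duration $d_i\ge0$. There is a set $\mathcal{P}$ of precedence constraints, i.e. ordered pairs $(i,j)$ meaning that $a_i$ must be completed before $a_j$ begins, and a set $\mathcal{M}_0$ of mutex constraints, i.e. unordered pairs of distinct tasks that may not be executed simultaneously. For each robot $r$ and tasks $a_i,a_j$ there are given travel times $\tau_r(i)\in[0,\infty]$ (from the initial position of $r$ to the site of $a_i$) and $\tau_r(i,j)\in[0,\infty]$ (from $a_i$ to $a_j$), the value $\infty$ meaning that no collision-free path exists. **Allocations.** An allocation is a matrix $A\in\{0,1\}^{M\times N}$, with $A_{mr}=1$ iff robot $r$ is assigned to task $a_m$. It is valid if $AQ\ge Y^*$ element-wise. **Schedules.** A schedule is a vector of start times $\sigma=(s_1,\dots,s_M)$ and its makespan is $C(\sigma)=\max_i(s_i+d_i)$. For an allocation $A$, put $x_i(A)=\max\{\tau_r(i): A_{ir}=1\}$ and $x_{ij}(A)=\max\{\tau_r(i,j): A_{ir}=A_{jr}=1\}$ (a maximum over the empty set is $0$). Let $\mathcal{M}(A)$ be $\mathcal{M}_0$ together with all pairs of distinct tasks that share an assigned robot, and let $\mathcal{M}^R(A)$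 be $\mathcal{M}(A)$ with the pairs already related by a precedence constraint removed. A schedule is feasible for $A$ if - $s_i\ge x_i(A)$ for all $i$; - $s_j\ge s_i+d_i+x_{ij}(A)$ for all $(i,j)\in\mathcal{P}$; - for each $\{i,j\}\in\mathcal{M}^R(A)$, either $s_j\ge s_i+d_i+x_{ij}(A)$ or $s_i\ge s_j+d_j+x_{ji}(A)$. (These are the constraints of a mixed-integer linear program minimizing the makespan, with the either/or encoded by binary precedence variables.) If feasible schedules exist, $\sigma_A$ denotes one of minimal makespan. A solution consists of a valid allocation together with a feasible schedule (and the associated motion plans realizing the travel times). **Bounds on the makespan.** $C(\sigma_{LB})=\max_m d_m$ and $C(\sigma_{UB})=\frac{2Mz}{w}+\sum_{m=1}^M d_m$, where $z>0$ is the length of the longest possible path in the environment and $w>0$ is the speed of the slowest robot (so every finite travel time is at most $z/w$). **Heuristics.** The nodes of the task allocation graph are the allocations; write $A_N$ for the allocation of node $N$ and $\sigma_N=\sigma_{A_N}$ for its schedule. There is a directed edge from $N_p$ to $N$ iff $A_N$ is obtained from $A_{N_p}$ by changing exactly one entry from $0$ to $1$ (assigning one additional robot to one task). The root is the zero allocation. Define $$f_{apr}(N)=\frac{\|\max(Y^*-A_NQ,\,0)\|_{1,1}}{\|Y^*\|_{1,1}},\qquad f_{nsq}(N)=\frac{C(\sigma_N)-C(\sigma_{LB})}{C(\sigma_{UB})-C(\sigma_{LB})},$$ where the maximum is element-wise and $\|\cdot\|_{1,1}$ is the sum of absolute values of entries, and $f_{tetaq}(N)=\alpha f_{apr}(N)+(1-\alpha)f_{nsq}(N)$.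 **Search (D-ITAGS).** The open set initially contains only the root. At each step a node of the open set with minimal $f_{tetaq}$ (ties broken arbitrarily) is selected. If its allocation is valid (equivalently $f_{apr}=0$), the search stops and returns this node $\hat N$. Otherwise the node is removed from the open set, and all its children not previously generated and admitting a feasible schedule are added to the open set; nodes whose allocation admits no feasible schedule are discarded. *)

theory Defs
  imports "HOL-Analysis.Analysis"
begin

text \<open>
  Tasks, robots and traits are the elements of the finite types \<open>'m\<close>, \<open>'r\<close> and \<open>'u\<close>.
  A matrix with rows indexed by tasks and columns indexed by robots has type
  \<open>real ^ 'r ^ 'm\<close>.  Travel times are extended reals; \<open>\<infinity>\<close> means that there is no
  collision-free path.
\<close>

record ('m, 'r, 'u) ta_problem =
  team :: "real ^ 'u::finite ^ 'r::finite"
  desired :: "real ^ 'u::finite ^ 'm::finite"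
  duration :: "'m::finite \<Rightarrow> real"
  precedence :: "('m::finite \<times> 'm) set"
  mutex0 :: "'m::finite set set"
  init_travel :: "'r::finite \<Rightarrow> 'm::finite \<Rightarrow> ereal"
  travel :: "'r::finite \<Rightarrow> 'm::finite \<Rightarrow> 'm \<Rightarrow> ereal"
  longest_path :: real
  slowest_speed :: real

definition wf_problem :: "('m::finite, 'r::finite, 'u::finite) ta_problem \<Rightarrow> bool" where
  "wf_problem T \<longleftrightarrow>
     0 \<le> team T \<and> 0 \<le> desired T \<and> desired T \<noteq> 0 \<and>
     (\<forall>i. 0 \<le> duration T i) \<and>
     (\<forall>p\<in>mutex0 T. \<exists>i j. i \<noteq> j \<and> p = {i, j}) \<and>
     (\<forall>r i. 0 \<le> init_travel T r i) \<and>
     (\<forall>r i j. 0 \<le> travel T r i j) \<and>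
     0 < longest_path T \<and> 0 < slowest_speed T \<and>
     (\<forall>r i. init_travel T r i \<noteq> \<infinity> \<longrightarrow>
        init_travel T r i \<le> ereal (longest_path T / slowest_speed T)) \<and>
     (\<forall>r i j. travel T r i j \<noteq> \<infinity> \<longrightarrow>
        travel T r i j \<le> ereal (longest_path T / slowest_speed T))"

definition allocation :: "real ^ 'r ^ 'm \<Rightarrow> bool" where
  "allocation A \<longleftrightarrow> (\<forall>m r. A $ m $ r \<in> {0, 1})"

definition valid :: "('m::finite, 'r::finite, 'u::finite) ta_problem \<Rightarrow> real ^ 'r ^ 'm \<Rightarrow> bool" where
  "valid T A \<longleftrightarrow> desired T \<le> A ** team T"

text \<open>Travel times are nonnegative, so the inserted 0 only matters for the empty maximum.\<close>

definition init_delay ::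
  "('m::finite, 'r::finite, 'u::finite) ta_problem \<Rightarrow> real ^ 'r ^ 'm \<Rightarrow> 'm \<Rightarrow> ereal" where
  "init_delay T A i = Max (insert 0 {init_travel T r i | r. A $ i $ r = 1})"

definition delay ::
  "('m::finite, 'r::finite, 'u::finite) ta_problem \<Rightarrow> real ^ 'r ^ 'm \<Rightarrow> 'm \<Rightarrow> 'm \<Rightarrow> ereal" where
  "delay T A i j = Max (insert 0 {travel T r i j | r. A $ i $ r = 1 \<and> A $ j $ r = 1})"

definition mutex ::
  "('m::finite, 'r::finite, 'u::finite) ta_problem \<Rightarrow> real ^ 'r ^ 'm \<Rightarrow> 'm set set" where
  "mutex T A = mutex0 T \<union>
     {{i, j} | i j. i \<noteq> j \<and> (\<exists>r. A $ i $ r = 1 \<and> A $ j $ r = 1)}"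

definition reduced_mutex ::
  "('m::finite, 'r::finite, 'u::finite) ta_problem \<Rightarrow> real ^ 'r ^ 'm \<Rightarrow> 'm set set" where
  "reduced_mutex T A =
     mutex T A - {{i, j} | i j. (i, j) \<in> precedence T}"

definition feasible ::
  "('m::finite, 'r::finite, 'u::finite) ta_problem \<Rightarrow> real ^ 'r ^ 'm \<Rightarrow> real ^ 'm \<Rightarrow> bool" where
  "feasible T A \<sigma> \<longleftrightarrow>
     (\<forall>i. init_delay T A i \<le> ereal (\<sigma> $ i)) \<and>
     (\<forall>(i, j)\<in>precedence T.
        ereal (\<sigma> $ i + duration T i) + delay T A i j \<le> ereal (\<sigma> $ j)) \<and>
     (\<forall>i j. {i, j} \<in> reduced_mutex T A \<longrightarrow>
        ereal (\<sigma> $ i + duration T i) + delay T A i j \<le> ereal (\<sigma> $ j) \<or>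
        ereal (\<sigma> $ j + duration T j) + delay T A j i \<le> ereal (\<sigma> $ i))"

definition schedulable ::
  "('m::finite, 'r::finite, 'u::finite) ta_problem \<Rightarrow> real ^ 'r ^ 'm \<Rightarrow> bool" where
  "schedulable T A \<longleftrightarrow> (\<exists>\<sigma>. feasible T A \<sigma>)"

definition is_solution ::
  "('m::finite, 'r::finite, 'u::finite) ta_problem \<Rightarrow> real ^ 'r ^ 'm \<Rightarrow> real ^ 'm \<Rightarrow> bool" where
  "is_solution T A \<sigma> \<longleftrightarrow> allocation A \<and> valid T A \<and> feasible T A \<sigma>"

definition makespan ::
  "('m::finite, 'r::finite, 'u::finite) ta_problem \<Rightarrow> real ^ 'm \<Rightarrow> real" where
  "makespan T \<sigma> = Max (range (\<lambda>i. \<sigma> $ i + duration T i))"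

definition best_schedule ::
  "('m::finite, 'r::finite, 'u::finite) ta_problem \<Rightarrow> real ^ 'r ^ 'm \<Rightarrow> real ^ 'm" where
  "best_schedule T A = arg_min (makespan T) (feasible T A)"

definition optimal_makespan :: "('m::finite, 'r::finite, 'u::finite) ta_problem \<Rightarrow> real" where
  "optimal_makespan T =
     Min {makespan T (best_schedule T A) | A. allocation A \<and> valid T A \<and> schedulable T A}"

definition makespan_LB :: "('m::finite, 'r::finite, 'u::finite) ta_problem \<Rightarrow> real" where
  "makespan_LB T = Max (range (duration T))"

definition makespan_UB :: "('m::finite, 'r::finite, 'u::finite) ta_problem \<Rightarrow> real" where
  "makespan_UB T =
     2 * real CARD('m) * longest_path T / slowest_speed T + (\<Sum>m\<in>UNIV. duration T m)"

definition norm11 :: "real ^ 'u ^ 'm \<Rightarrow> real" where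
  "norm11 B = (\<Sum>m\<in>UNIV. \<Sum>u\<in>UNIV. \<bar>B $ m $ u\<bar>)"

definition f_apr ::
  "('m::finite, 'r::finite, 'u::finite) ta_problem \<Rightarrow> real ^ 'r ^ 'm \<Rightarrow> real" where
  "f_apr T A =
     norm11 (\<chi> m u. max ((desired T - A ** team T) $ m $ u) 0) / norm11 (desired T)"

definition f_nsq ::
  "('m::finite, 'r::finite, 'u::finite) ta_problem \<Rightarrow> real ^ 'r ^ 'm \<Rightarrow> real" where
  "f_nsq T A =
     (makespan T (best_schedule T A) - makespan_LB T) / (makespan_UB T - makespan_LB T)"

definition f_tetaq ::
  "('m::finite, 'r::finite, 'u::finite) ta_problem \<Rightarrow> real \<Rightarrow> real ^ 'r ^ 'm \<Rightarrow> real" where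
  "f_tetaq T \<alpha> A = \<alpha> * f_apr T A + (1 - \<alpha>) * f_nsq T A"

definition child :: "real ^ 'r ^ 'm \<Rightarrow> real ^ 'r ^ 'm \<Rightarrow> bool" where
  "child A B \<longleftrightarrow> allocation A \<and> allocation B \<and>
     (\<exists>m r. A $ m $ r = 0 \<and> B $ m $ r = 1 \<and>
        (\<forall>m' r'. (m', r') \<noteq> (m, r) \<longrightarrow> B $ m' $ r' = A $ m' $ r'))"

text \<open>
  \<open>ditags_state T \<alpha> Open Gen\<close>: some run of the search reaches a point at which the open set
  is \<open>Open\<close> and the nodes generated so far, including the discarded ones, are \<open>Gen\<close>.  Nodes
  are identified with their allocations.  Since ties are broken arbitrarily, there can be
  several runs and several nodes that may be returned.
\<close>

inductive ditags_state ::
  "('m::finite, 'r::finite, 'u::finite) ta_problem \<Rightarrow> real \<Rightarrow>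
   (real ^ 'r ^ 'm) set \<Rightarrow> (real ^ 'r ^ 'm) set \<Rightarrow> bool"
  for T :: "('m::finite, 'r::finite, 'u::finite) ta_problem" and \<alpha> :: real where
  root: "ditags_state T \<alpha> {0} {0}"
| expand: "ditags_state T \<alpha> Open Gen \<Longrightarrow>
    is_arg_min (f_tetaq T \<alpha>) (\<lambda>A. A \<in> Open) A \<Longrightarrow> \<not> valid T A \<Longrightarrow>
    ditags_state T \<alpha>
      ((Open - {A}) \<union> {B. child A B \<and> B \<notin> Gen \<and> schedulable T B})
      (Gen \<union> {B. child A B})"

definition ditags_returns ::
  "('m::finite, 'r::finite, 'u::finite) ta_problem \<Rightarrow> real \<Rightarrow> real ^ 'r ^ 'm \<Rightarrow> bool" where
  "ditags_returns T \<alpha> A \<longleftrightarrow>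
     (\<exists>Open Gen. ditags_state T \<alpha> Open Gen \<and>
        is_arg_min (f_tetaq T \<alpha>) (\<lambda>A. A \<in> Open) A \<and> valid T A)"

end

theory Submission imports Defs begin

text \<open>
  Removing assignments from an allocation only relaxes the scheduling constraints, so every
  suballocation of an optimal allocation \<open>A\<^sup>*\<close> is schedulable, with makespan at most
  that of \<open>A\<^sup>*\<close>.  At every stage of the search a maximal generated suballocation \<open>B\<close> of
  \<open>A\<^sup>*\<close> lies in the open set: otherwise it was expanded, hence is not valid, hence differs from
  \<open>A\<^sup>*\<close>, and so has a generated child below \<open>A\<^sup>*\<close>.  Comparing the returned node, where \<open>f_apr\<close>
  vanishes, with such a \<open>B\<close>, where \<open>f_apr \<le> 1\<close>, gives the bound.
\<close>

subsection \<open>Allocations\<close>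

lemma allocation_zero: "allocation 0"
  by (simp add: allocation_def)

lemma allocation_nonneg: "allocation A \<Longrightarrow> 0 \<le> A $ m $ r"
  unfolding allocation_def by (metis insert_iff order_refl singletonD zero_le_one)

lemma allocation_le_one: "allocation A \<Longrightarrow> A $ m $ r \<le> 1"
  unfolding allocation_def by (metis insert_iff order_refl singletonD zero_le_one)

lemma zero_le_allocation: "allocation A \<Longrightarrow> 0 \<le> A"
  by (simp add: less_eq_vec_def allocation_nonneg)

lemma allocation_eq_oneD:
  assumes "allocation B" "A \<le> B" "A $ m $ r = 1"
  shows "B $ m $ r = 1"
  using allocation_le_one[OF assms(1), of m r] assms(2,3)
  by (simp add: less_eq_vec_def) (metis order_antisym)

lemma finite_allocations: "finite {A :: real ^ 'r::finite ^ 'm::finite. allocation A}"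
proof (rule finite_subset)
  show "{A :: real ^ 'r ^ 'm. allocation A} \<subseteq> range (\<lambda>p. \<chi> m r. if p m r then 1 else 0)"
  proof
    fix A :: "real ^ 'r ^ 'm"
    assume "A \<in> {A. allocation A}"
    then have "A = (\<chi> m r. if A $ m $ r = 1 then 1 else 0)"
      by (auto simp: allocation_def vec_eq_iff)
    then show "A \<in> range (\<lambda>p. \<chi> m r. if p m r then 1 else 0)"
      by (rule range_eqI[of _ _ "\<lambda>m r. A $ m $ r = 1"])
  qed
qed simp

text \<open>Entries are 0 or 1, so where two comparable allocations differ, the smaller has 0 and
  the larger 1. Switching one such entry of \<open>A\<close> to 1 gives the child.\<close>

lemma child_between:
  assumes "allocation A" "allocation B" "A \<le> B" "A \<noteq> B"
  obtains C where "child A C" "C \<le> B" "A < C"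
proof -
  obtain m r where mr: "A $ m $ r \<noteq> B $ m $ r"
    using assms(4) by (auto simp: vec_eq_iff)
  have le: "A $ i $ j \<le> B $ i $ j" for i j
    using assms(3) by (simp add: less_eq_vec_def)
  have mr': "A $ m $ r = 0" "B $ m $ r = 1"
    using mr le[of m r] assms(1,2) unfolding allocation_def
    by (metis insert_iff singletonD not_one_le_zero)+
  define C where "C = (\<chi> i j. if i = m \<and> j = r then 1 else A $ i $ j)"
  have "child A C"
    unfolding child_def
    using assms(1) mr' by (auto simp: C_def allocation_def intro!: exI[of _ m] exI[of _ r])
  moreover have "C \<le> B"
    using le mr' by (auto simp: C_def less_eq_vec_def)
  moreover have "A \<le> C"
    using mr' by (auto simp: C_def less_eq_vec_def)
  moreover have "C $ m $ r \<noteq> A $ m $ r"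
    using mr' by (simp add: C_def)
  ultimately show thesis
    using that by (metis order.not_eq_order_implies_strict)
qed

subsection \<open>Schedules\<close>

lemma init_delay_nonneg: "0 \<le> init_delay T A i"
  by (simp add: init_delay_def)

lemma init_delay_mono:
  assumes "allocation B" "A \<le> B"
  shows "init_delay T A i \<le> init_delay T B i"
  unfolding init_delay_def
  by (rule Max_mono) (auto dest: allocation_eq_oneD[OF assms])

lemma delay_mono:
  assumes "allocation B" "A \<le> B"
  shows "delay T A i j \<le> delay T B i j"
  unfolding delay_def
  by (rule Max_mono) (auto dest: allocation_eq_oneD[OF assms])

text \<open>More assignments can only add shared-robot pairs, while the pairs subtracted because of
  \<open>precedence T\<close> do not depend on the allocation.\<close>

lemma reduced_mutex_mono:
  assumes "allocation B" "A \<le> B"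
  shows "reduced_mutex T A \<subseteq> reduced_mutex T B"
proof -
  have "mutex T A \<subseteq> mutex T B"
    unfolding mutex_def by (intro Un_mono Collect_mono) (auto dest: allocation_eq_oneD[OF assms])
  then show ?thesis
    by (auto simp: reduced_mutex_def)
qed

lemma feasible_antimono:
  assumes "allocation B" "A \<le> B" "feasible T B \<sigma>"
  shows "feasible T A \<sigma>"
proof -
  have *: "s + delay T A i j \<le> t" if "s + delay T B i j \<le> t" for s t i j
    using that delay_mono[OF assms(1,2), of T i j] by (meson add_left_mono order_trans)
  show ?thesis
    unfolding feasible_def
  proof (intro conjI allI ballI impI)
    show "init_delay T A i \<le> ereal (\<sigma> $ i)" for i
      using assms(3) init_delay_mono[OF assms(1,2), of T i] order_trans
      unfolding feasible_def by blast
    show "case p of (i, j) \<Rightarrow> ereal (\<sigma> $ i + duration T i) + delay T A i j \<le> ereal (\<sigma> $ j)"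
      if "p \<in> precedence T" for p
      using assms(3) that * by (auto simp: feasible_def)
    show "ereal (\<sigma> $ i + duration T i) + delay T A i j \<le> ereal (\<sigma> $ j) \<or>
        ereal (\<sigma> $ j + duration T j) + delay T A j i \<le> ereal (\<sigma> $ i)"
      if "{i, j} \<in> reduced_mutex T A" for i j
      using assms(3) that reduced_mutex_mono[OF assms(1,2), of T] *
      unfolding feasible_def by (meson subsetD)
  qed
qed

lemma start_nonneg:
  assumes "feasible T A \<sigma>"
  shows "0 \<le> \<sigma> $ i"
  using assms init_delay_nonneg[of T A i] unfolding feasible_def
  by (metis ereal_less_eq(5) order_trans)

lemma start_le_makespan: "\<sigma> $ i + duration T i \<le> makespan T \<sigma>"
  unfolding makespan_def by simp

text \<open>A finite \<open>c\<close> gives a weak inequality between continuous functions; an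
  infinite \<open>c\<close> gives the empty set or the whole space.\<close>

lemma closed_delay_constraint:
  "closed {\<sigma> :: real ^ 'm. ereal (\<sigma> $ i + d) + c \<le> ereal (\<sigma> $ j)}"
  by (cases c) (auto intro!: closed_Collect_le continuous_intros)

lemma closed_start_constraint: "closed {\<sigma> :: real ^ 'm. c \<le> ereal (\<sigma> $ i)}"
  by (cases c) (auto intro!: closed_Collect_le continuous_intros)

text \<open>The either/or is a union of two closed sets, and the premises of the implications do not
  depend on the schedule, so closedness survives.\<close>

lemma closed_feasible: "closed {\<sigma>. feasible T A \<sigma>}"
  unfolding feasible_def case_prod_beta Ball_def
  by (intro closed_Collect_conj closed_Collect_all closed_Collect_imp closed_Collect_disj
        open_Collect_const closed_start_constraint closed_delay_constraint)

lemma continuous_on_Max: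
  fixes f :: "'i \<Rightarrow> 'a::topological_space \<Rightarrow> 'b::linorder_topology"
  assumes "finite I" "I \<noteq> {}" "\<And>i. i \<in> I \<Longrightarrow> continuous_on S (f i)"
  shows "continuous_on S (\<lambda>x. Max ((\<lambda>i. f i x) ` I))"
  using assms by (induction rule: finite_ne_induct) (auto intro!: continuous_on_max)

lemma continuous_on_makespan: "continuous_on S (makespan T)"
  unfolding makespan_def by (intro continuous_on_Max continuous_intros) auto

text \<open>\<open>arg_min\<close> is a Hilbert choice, informative only once a minimiser exists.
  Existence follows from compactness, since a continuous makespan is minimised over a closed set
  that can be cut down to a bounded one.\<close>

lemma best_schedule_is_arg_min:
  assumes "wf_problem T" "schedulable T A"
  shows "is_arg_min (makespan T) (feasible T A) (best_schedule T A)"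
proof -
  obtain \<sigma>0 where \<sigma>0: "feasible T A \<sigma>0"
    using assms(2) by (auto simp: schedulable_def)
  \<comment> \<open>Start times are nonnegative and, as durations are nonnegative, at most the
    makespan. Hence the box contains every feasible schedule no worse than
    \<open>\<sigma>0\<close>.\<close>
  define K where "K = {\<sigma>. feasible T A \<sigma>} \<inter> cbox 0 (\<chi> i. makespan T \<sigma>0)"
  have dur: "0 \<le> duration T i" for i
    using assms(1) by (simp add: wf_problem_def)
  have K: "\<sigma> \<in> K" if "feasible T A \<sigma>" "makespan T \<sigma> \<le> makespan T \<sigma>0" for \<sigma>
  proof -
    have "\<sigma> $ i \<le> makespan T \<sigma>0" for i
      using start_le_makespan[of \<sigma> i T] dur[of i] that(2) by linarith
    then show ?thesis
      using that(1) start_nonneg[OF that(1)] by (simp add: K_def mem_box_cart)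
  qed
  have "compact K"
    unfolding K_def by (intro closed_Int_compact closed_feasible compact_cbox)
  moreover have "K \<noteq> {}"
    using K[OF \<sigma>0] by auto
  ultimately obtain \<sigma> where \<sigma>: "\<sigma> \<in> K" "\<forall>\<rho>\<in>K. makespan T \<sigma> \<le> makespan T \<rho>"
    using continuous_attains_inf[OF _ _ continuous_on_makespan] by blast
  have "is_arg_min (makespan T) (feasible T A) \<sigma>"
    unfolding is_arg_min_linorder
  proof (intro conjI allI impI)
    show "feasible T A \<sigma>"
      using \<sigma>(1) by (simp add: K_def)
    show "makespan T \<sigma> \<le> makespan T \<rho>" if "feasible T A \<rho>" for \<rho>
      \<comment> \<open>A schedule \<open>\<rho>\<close> worse than \<open>\<sigma>0\<close> may lie
        outside \<open>K\<close>, but then it is beaten by \<open>\<sigma>0\<close>, which lies in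
        \<open>K\<close>.\<close>
      using \<sigma>(2) K[OF that] K[OF \<sigma>0] by (meson linear order_refl order_trans)
  qed
  then show ?thesis
    unfolding best_schedule_def arg_min_def by (rule someI)
qed

lemma makespan_best_schedule_mono:
  assumes "wf_problem T" "allocation B" "A \<le> B" "schedulable T B"
  shows "makespan T (best_schedule T A) \<le> makespan T (best_schedule T B)"
proof -
  have "schedulable T A"
    using assms(4) feasible_antimono[OF assms(2,3)] by (auto simp: schedulable_def)
  then show ?thesis
    using best_schedule_is_arg_min[OF assms(1)] assms(4) feasible_antimono[OF assms(2,3)]
    unfolding is_arg_min_linorder by blast
qed

text \<open>There are finitely many allocations, so the \<open>Min\<close> is taken over a finite
  set, nonempty by assumption.\<close>

lemma optimal_makespan_attained:
  assumes "\<exists>A \<sigma>. is_solution T A \<sigma>"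
  obtains A where "allocation A" "valid T A" "schedulable T A"
    "optimal_makespan T = makespan T (best_schedule T A)"
proof -
  let ?S = "{makespan T (best_schedule T A) | A. allocation A \<and> valid T A \<and> schedulable T A}"
  have "finite ?S"
    by (rule finite_subset[OF _ finite_imageI[OF finite_allocations,
          of "\<lambda>A. makespan T (best_schedule T A)"]]) auto
  moreover have "?S \<noteq> {}"
    using assms by (auto simp: is_solution_def schedulable_def)
  ultimately have "optimal_makespan T \<in> ?S"
    unfolding optimal_makespan_def by (rule Min_in)
  then show thesis
    using that by blast
qed

subsection \<open>Heuristics\<close>

text \<open>One duration is at most the sum of all, and the travel term of the upper bound is
  strictly positive. This makes the denominator of \<open>f_nsq\<close> positive.\<close>

lemma makespan_LB_less_UB:
  fixes T :: "('m::finite, 'r::finite, 'u::finite) ta_problem"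
  assumes "wf_problem T"
  shows "makespan_LB T < makespan_UB T"
proof -
  have "makespan_LB T \<in> range (duration T)"
    unfolding makespan_LB_def by (rule Max_in) auto
  then obtain i where "makespan_LB T = duration T i"
    by blast
  also have "\<dots> \<le> (\<Sum>m\<in>UNIV. duration T m)"
    using assms by (intro member_le_sum) (auto simp: wf_problem_def)
  also have "\<dots> < makespan_UB T"
    using assms by (simp add: makespan_UB_def wf_problem_def)
  finally show ?thesis .
qed

lemma norm11_nonneg: "0 \<le> norm11 B"
  by (simp add: norm11_def sum_nonneg)

lemma f_apr_nonneg: "0 \<le> f_apr T A"
  by (simp add: f_apr_def norm11_nonneg)

text \<open>As \<open>A ** team T\<close> is nonnegative, the shortfall in each entry is at most the
  desired amount.\<close>

lemma f_apr_le_1: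
  assumes "wf_problem T" "allocation A"
  shows "f_apr T A \<le> 1"
proof -
  have "0 \<le> (A ** team T) $ m $ u" for m u
    using assms allocation_nonneg[OF assms(2)]
    by (auto simp: matrix_matrix_mult_def wf_problem_def less_eq_vec_def intro!: sum_nonneg)
  moreover have "0 \<le> desired T $ m $ u" for m u
    using assms(1) by (simp add: wf_problem_def less_eq_vec_def)
  ultimately have "norm11 (\<chi> m u. max ((desired T - A ** team T) $ m $ u) 0) \<le> norm11 (desired T)"
    unfolding norm11_def by (intro sum_mono) simp
  then show ?thesis
    \<comment> \<open>A zero denominator would make the quotient 0, so its nonnegativity
      suffices.\<close>
    using norm11_nonneg[of "desired T"] by (auto simp: f_apr_def divide_le_eq_1 less_le)
qed

subsection \<open>The search\<close>

lemma ditags_state_root_generated: "ditags_state T \<alpha> Open Gen \<Longrightarrow> 0 \<in> Gen"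
  by (induction rule: ditags_state.induct) auto

text \<open>Invariant of the search: a node leaves the open set only by expansion, which generates
  all its children. Discarded nodes are in \<open>Gen\<close> without ever being open;
  \<open>schedulable\<close> excludes them.\<close>

lemma ditags_state_generated:
  assumes "ditags_state T \<alpha> Open Gen" "B \<in> Gen" "schedulable T B"
  shows "B \<in> Open \<or> \<not> valid T B \<and> {C. child B C} \<subseteq> Gen"
  using assms by (induction arbitrary: B rule: ditags_state.induct) blast+

lemma ditags_state_open_below:
  assumes "ditags_state T \<alpha> Open Gen" "allocation A" "valid T A" "schedulable T A"
  obtains B where "B \<in> Open" "allocation B" "B \<le> A"
proof -
  let ?S = "{B \<in> Gen. allocation B \<and> B \<le> A}"
  have "finite ?S"
    by (rule finite_subset[OF _ finite_allocations]) auto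
  moreover have "0 \<in> ?S"
    using ditags_state_root_generated[OF assms(1)] assms(2)
    by (simp add: allocation_zero zero_le_allocation)
  ultimately obtain B where B: "B \<in> ?S" and max: "\<forall>C\<in>?S. B \<le> C \<longrightarrow> B = C"
    using finite_has_maximal[of ?S] by blast
  have "schedulable T B"
    using B assms(4) feasible_antimono[OF assms(2)] by (auto simp: schedulable_def)
  then consider "B \<in> Open" | "\<not> valid T B" "{C. child B C} \<subseteq> Gen"
    using ditags_state_generated[OF assms(1)] B by blast
  then have "B \<in> Open"
  proof cases
    case 2
    then have "B \<noteq> A"
      using assms(3) by blast
    then obtain C where C: "child B C" "C \<le> A" "B < C"
      using B assms(2) child_between by blast
    then have "C \<in> ?S"
      using 2 by (auto simp: child_def)
    then show ?thesis
      using max C(3) by auto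
  qed
  then show thesis
    using that B by blast
qed

theorem theorem1:
  fixes T :: "('m::finite, 'r::finite, 'u::finite) ta_problem"
    and \<alpha> :: real
    and A_hat :: "real ^ 'r ^ 'm"
  assumes "wf_problem T"
    and "\<exists>A \<sigma>. is_solution T A \<sigma>"
    and "0 \<le> \<alpha>" and "\<alpha> \<le> 1"
    and "\<alpha> < 1 / 2"
    and "ditags_returns T \<alpha> A_hat"
  shows "makespan T (best_schedule T A_hat) - optimal_makespan T
           \<le> \<alpha> / (1 - \<alpha>) * (makespan_UB T - makespan_LB T)"
proof -
  let ?C = "\<lambda>A. makespan T (best_schedule T A)"
  define D where "D = makespan_UB T - makespan_LB T"
  have D: "0 < D"
    using makespan_LB_less_UB[OF assms(1)] by (simp add: D_def)
  obtain A where A: "allocation A" "valid T A" "schedulable T A" "optimal_makespan T = ?C A"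
    using optimal_makespan_attained[OF assms(2)] .
  obtain Open Gen where run: "ditags_state T \<alpha> Open Gen"
    and min: "is_arg_min (f_tetaq T \<alpha>) (\<lambda>A. A \<in> Open) A_hat"
    using assms(6) by (auto simp: ditags_returns_def)
  obtain B where B: "B \<in> Open" "allocation B" "B \<le> A"
    using ditags_state_open_below[OF run A(1-3)] .
  \<comment> \<open>The summand \<alpha> * \<open>f_apr T A_hat\<close> is nonnegative and is
    dropped.\<close>
  have "(1 - \<alpha>) * f_nsq T A_hat \<le> f_tetaq T \<alpha> A_hat"
    using assms(3) by (simp add: f_tetaq_def f_apr_nonneg)
  also have "\<dots> \<le> f_tetaq T \<alpha> B"
    using min B(1) by (simp add: is_arg_min_linorder)
  also have "\<dots> \<le> \<alpha> + (1 - \<alpha>) * f_nsq T B"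
    using f_apr_le_1[OF assms(1) B(2)] assms(3) by (simp add: f_tetaq_def mult_left_le)
  \<comment> \<open>Division by 1 - \<alpha>, which is positive because \<alpha> < 1/2.\<close>
  finally have "f_nsq T A_hat - f_nsq T B \<le> \<alpha> / (1 - \<alpha>)"
    using assms(5) by (simp add: field_simps)
  moreover have "f_nsq T A_hat - f_nsq T B = (?C A_hat - ?C B) / D"
    by (simp add: f_nsq_def D_def flip: diff_divide_distrib)
  ultimately have "?C A_hat - ?C B \<le> \<alpha> / (1 - \<alpha>) * D"
    using D by (simp add: pos_divide_le_eq)
  \<comment> \<open>Since \<open>B \<le> A\<close>, the makespan of \<open>B\<close> is at most that
    of \<open>A\<close>, the optimal one.\<close>
  then show ?thesis
    using makespan_best_schedule_mono[OF assms(1) A(1) B(3) A(3)] A(4) by (simp add: D_def)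
qed

end
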